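(* Let $F: A\times B\to Z$ be a single-valued mapping and let $(\bar x,\bar y)\in A\times B$. If $F$ is partially Fréchet differentiable with respect to the first (respectively, second) variable at $(\bar x,\bar y)$ with partial Fréchet derivative $\nabla_1F(\bar x,\bar y)$ (respectively, $\nabla_2F(\bar x,\bar y)$), then $F$ is partially Gâteaux differentiable with respect to the first (respectively, second) variable at $(\bar x,\bar y)$ and $$\partial_1F(\bar x,\bar y)(v)=\nabla_1F(\bar x,\bar y)(v)\quad\text{for any } v\in X\setminus\{\theta_X\}$$ (respectively, $$\partial_2F(\bar x,\bar y)(u)=\nabla_2F(\bar x,\bar y)(u)\quad\text{for any } u\in Y\setminus\{\theta_Y\}).$$
   Context: $(X,\|\cdot\|_X)$, $(Y,\|\cdot\|_Y)$, $(Z,\|\cdot\|_Z)$ are Banach spaces with null elements $\theta_X,\theta_Y,\theta_Z$; $A\subseteq X$ and $B\subseteq Y$ are nonempty convex open subsets; $t$ denotes a real variable. $F:A\times B\to Z$ is partially Gâteaux differentiable with respect to the first variable at $(\bar x,\bar y)$ if for every $v\in X\setminus\{\theta_X\}$ the limit $\partial_1F(\bar x,\bar y)(v):=\lim_{t\to0}\frac{F(\bar x+tv,\bar y)-F(\bar x,\bar y)}{t}$ exists in $Z$; with respect to the second variable if for every $u\in Y\setminus\{\theta_Y\}$ the limit $\partial_2F(\bar x,\bar y)(u):=\lim_{t\to0}\frac{F(\bar x,\bar y+tu)-F(\bar x,\bar y)}{t}$ exists in $Z$. $F$ is partially Fréchet differentiable with respect to the first variable at $(\bar x,\bar y)$ if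 there is a continuous linear mapping $\nabla_1F(\bar x,\bar y):X\to Z$ with $\lim_{u\to\theta_X}\frac{F(\bar x+u,\bar y)-F(\bar x,\bar y)-\nabla_1F(\bar x,\bar y)(u)}{\|u\|_X}=\theta_Z$; with respect to the second variable if there is a continuous linear mapping $\nabla_2F(\bar x,\bar y):Y\to Z$ with $\lim_{w\to\theta_Y}\frac{F(\bar x,\bar y+w)-F(\bar x,\bar y)-\nabla_2F(\bar x,\bar y)(w)}{\|w\|_Y}=\theta_Z$. *)

theory Defs
  imports "HOL-Analysis.Analysis"
begin

text \<open>
  A mapping F from A \<times> B to Z is represented by a total function on pairs. Its values outside
  A \<times> B play no role below: A and B are open and the base point lies in A \<times> B, so each of the
  following limits depends only on the values of F in A \<times> B.
\<close>

definition partial_gateaux_differentiable1 ::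
  "('x::real_normed_vector \<times> 'y \<Rightarrow> 'z::real_normed_vector) \<Rightarrow> 'x \<times> 'y \<Rightarrow> bool" where
  "partial_gateaux_differentiable1 F = (\<lambda>(x, y). \<forall>v. v \<noteq> 0 \<longrightarrow>
     (\<exists>l. ((\<lambda>t::real. (F (x + t *\<^sub>R v, y) - F (x, y)) /\<^sub>R t) \<longlongrightarrow> l) (at 0)))"

definition partial_gateaux_differentiable2 ::
  "('x \<times> 'y::real_normed_vector \<Rightarrow> 'z::real_normed_vector) \<Rightarrow> 'x \<times> 'y \<Rightarrow> bool" where
  "partial_gateaux_differentiable2 F = (\<lambda>(x, y). \<forall>u. u \<noteq> 0 \<longrightarrow>
     (\<exists>l. ((\<lambda>t::real. (F (x, y + t *\<^sub>R u) - F (x, y)) /\<^sub>R t) \<longlongrightarrow> l) (at 0)))"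

text \<open>
  The partial Gateaux derivatives are only meaningful at directions where the limit exists;
  elsewhere \<^const>\<open>Lim\<close> returns an unspecified value.
\<close>

definition partial_gateaux_derivative1 ::
  "('x::real_normed_vector \<times> 'y \<Rightarrow> 'z::real_normed_vector) \<Rightarrow> 'x \<times> 'y \<Rightarrow> 'x \<Rightarrow> 'z" where
  "partial_gateaux_derivative1 F = (\<lambda>(x, y) v.
     Lim (at 0) (\<lambda>t::real. (F (x + t *\<^sub>R v, y) - F (x, y)) /\<^sub>R t))"

definition partial_gateaux_derivative2 ::
  "('x \<times> 'y::real_normed_vector \<Rightarrow> 'z::real_normed_vector) \<Rightarrow> 'x \<times> 'y \<Rightarrow> 'y \<Rightarrow> 'z" where
  "partial_gateaux_derivative2 F = (\<lambda>(x, y) u.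
     Lim (at 0) (\<lambda>t::real. (F (x, y + t *\<^sub>R u) - F (x, y)) /\<^sub>R t))"

definition has_partial_frechet_derivative1 ::
  "('x::real_normed_vector \<times> 'y \<Rightarrow> 'z::real_normed_vector) \<Rightarrow> ('x \<Rightarrow> 'z) \<Rightarrow> 'x \<times> 'y \<Rightarrow> bool" where
  "has_partial_frechet_derivative1 F D = (\<lambda>(x, y). ((\<lambda>x'. F (x', y)) has_derivative D) (at x))"

definition has_partial_frechet_derivative2 ::
  "('x \<times> 'y::real_normed_vector \<Rightarrow> 'z::real_normed_vector) \<Rightarrow> ('y \<Rightarrow> 'z) \<Rightarrow> 'x \<times> 'y \<Rightarrow> bool" where
  "has_partial_frechet_derivative2 F D = (\<lambda>(x, y). ((\<lambda>y'. F (x, y')) has_derivative D) (at y))"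

text \<open>
  Unfolded, these say that D is a continuous linear mapping for which the Frechet quotient
  tends to zero.
\<close>

lemma has_derivative_at_iff_quotient:
  "(f has_derivative D) (at x) \<longleftrightarrow>
     bounded_linear D \<and> ((\<lambda>h. (f (x + h) - f x - D h) /\<^sub>R norm h) \<longlongrightarrow> 0) (at 0)"
proof -
  have "((\<lambda>h. (f (x + h) - f x - D h) /\<^sub>R norm h) \<longlongrightarrow> 0) (at 0) \<longleftrightarrow>
        ((\<lambda>h. norm (f (x + h) - f x - D h) / norm h) \<longlongrightarrow> 0) (at 0)"
    by (subst tendsto_norm_zero_iff [symmetric]) (simp add: divide_inverse mult.commute)
  then show ?thesis
    by (simp add: has_derivative_at)
qed

lemma has_partial_frechet_derivative1_iff:
  "has_partial_frechet_derivative1 F D (x, y) \<longleftrightarrow>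
     bounded_linear D \<and>
     ((\<lambda>u. (F (x + u, y) - F (x, y) - D u) /\<^sub>R norm u) \<longlongrightarrow> 0) (at 0)"
  by (simp add: has_partial_frechet_derivative1_def has_derivative_at_iff_quotient)

lemma has_partial_frechet_derivative2_iff:
  "has_partial_frechet_derivative2 F D (x, y) \<longleftrightarrow>
     bounded_linear D \<and>
     ((\<lambda>w. (F (x, y + w) - F (x, y) - D w) /\<^sub>R norm w) \<longlongrightarrow> 0) (at 0)"
  by (simp add: has_partial_frechet_derivative2_def has_derivative_at_iff_quotient)

end

theory Submission
  imports Defs
begin

text \<open>
  Fix one variable of F and let f be the remaining partial map. A directional difference quotient
  of f is the difference quotient at 0 of the curve g(t) = f(x + t v), and if f has Frechet
  derivative D at x, then the chain rule makes g differentiable at 0 with derivative D(v); this is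
  \<open>has_derivative_imp_directional_limit\<close>. Applied to each of the two partial maps, it
  gives existence of the Gateaux limits, and uniqueness of limits in a normed space identifies
  their values with those of the Frechet derivative.
\<close>

text \<open>
  Since D(t v) = t D(v), the remainder quotient of g(t) = f(x + t v) at 0 is
  (g(t) - g(0) - t D(v)) / |t|. It differs from (g(t) - g(0)) / t - D(v) at most in sign, so the
  two have the same norm and tend to zero together.
\<close>

lemma has_derivative_imp_directional_limit:
  fixes f :: "'a::real_normed_vector \<Rightarrow> 'b::real_normed_vector"
  assumes "(f has_derivative D) (at x)"
  shows "((\<lambda>t::real. (f (x + t *\<^sub>R v) - f x) /\<^sub>R t) \<longlongrightarrow> D v) (at 0)"
proof -
  have lin: "D (t *\<^sub>R v) = t *\<^sub>R D v" for t
    using assms by (simp add: has_derivative_bounded_linear linear_simps(5))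
  have line: "((\<lambda>t::real. x + t *\<^sub>R v) has_derivative (\<lambda>t. t *\<^sub>R v)) (at 0)"
    by (auto intro!: derivative_eq_intros)
  have "((\<lambda>t. f (x + t *\<^sub>R v)) has_derivative (\<lambda>t. D (t *\<^sub>R v))) (at 0)"
    by (rule has_derivative_compose [OF line]) (simp add: assms)
  then have "((\<lambda>t. (f (x + t *\<^sub>R v) - f x - t *\<^sub>R D v) /\<^sub>R norm t) \<longlongrightarrow> 0) (at 0)"
    by (simp add: has_derivative_at_iff_quotient lin)
  then have remainder:
    "((\<lambda>t. norm ((f (x + t *\<^sub>R v) - f x - t *\<^sub>R D v) /\<^sub>R norm t)) \<longlongrightarrow> 0) (at 0)"
    by (rule tendsto_norm_zero)
  have "norm ((f (x + t *\<^sub>R v) - f x - t *\<^sub>R D v) /\<^sub>R norm t) =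
      norm ((f (x + t *\<^sub>R v) - f x) /\<^sub>R t - D v)" if "t \<noteq> 0" for t :: real
  proof -
    have "(f (x + t *\<^sub>R v) - f x) /\<^sub>R t - D v = (f (x + t *\<^sub>R v) - f x - t *\<^sub>R D v) /\<^sub>R t"
      using that by (simp add: scaleR_diff_right)
    then show ?thesis
      by simp
  qed
  then have "\<forall>\<^sub>F t in at (0::real).
      norm ((f (x + t *\<^sub>R v) - f x - t *\<^sub>R D v) /\<^sub>R norm t) =
      norm ((f (x + t *\<^sub>R v) - f x) /\<^sub>R t - D v)"
    by (simp add: eventually_at_filter)
  with remainder have "((\<lambda>t. norm ((f (x + t *\<^sub>R v) - f x) /\<^sub>R t - D v)) \<longlongrightarrow> 0) (at 0)"
    by (rule Lim_transform_eventually)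
  then show ?thesis
    by (simp add: tendsto_norm_zero_iff LIM_zero_iff)
qed

theorem theorem2p5:
  fixes A :: "'x::banach set" and B :: "'y::banach set"
    and F :: "'x \<times> 'y \<Rightarrow> 'z::banach"
    and xbar :: 'x and ybar :: 'y
  assumes "A \<noteq> {}" "convex A" "open A"
    and "B \<noteq> {}" "convex B" "open B"
    and "(xbar, ybar) \<in> A \<times> B"
  shows "(\<forall>D1. has_partial_frechet_derivative1 F D1 (xbar, ybar) \<longrightarrow>
            partial_gateaux_differentiable1 F (xbar, ybar) \<and>
            (\<forall>v. v \<noteq> 0 \<longrightarrow> partial_gateaux_derivative1 F (xbar, ybar) v = D1 v)) \<and>
         (\<forall>D2. has_partial_frechet_derivative2 F D2 (xbar, ybar) \<longrightarrow>
            partial_gateaux_differentiable2 F (xbar, ybar) \<and>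
            (\<forall>u. u \<noteq> 0 \<longrightarrow> partial_gateaux_derivative2 F (xbar, ybar) u = D2 u))"
proof (intro conjI allI impI)
  fix D1
  assume "has_partial_frechet_derivative1 F D1 (xbar, ybar)"
  then have lim: "((\<lambda>t::real. (F (xbar + t *\<^sub>R v, ybar) - F (xbar, ybar)) /\<^sub>R t) \<longlongrightarrow> D1 v) (at 0)" for v
    using has_derivative_imp_directional_limit [of "\<lambda>x. F (x, ybar)" D1 xbar v]
    by (simp add: has_partial_frechet_derivative1_def)
  show "partial_gateaux_differentiable1 F (xbar, ybar)"
    unfolding partial_gateaux_differentiable1_def using lim by blast
  show "partial_gateaux_derivative1 F (xbar, ybar) v = D1 v" for v
    unfolding partial_gateaux_derivative1_def using lim by (simp add: tendsto_Lim)
next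
  fix D2
  assume "has_partial_frechet_derivative2 F D2 (xbar, ybar)"
  then have lim: "((\<lambda>t::real. (F (xbar, ybar + t *\<^sub>R u) - F (xbar, ybar)) /\<^sub>R t) \<longlongrightarrow> D2 u) (at 0)" for u
    using has_derivative_imp_directional_limit [of "\<lambda>y. F (xbar, y)" D2 ybar u]
    by (simp add: has_partial_frechet_derivative2_def)
  show "partial_gateaux_differentiable2 F (xbar, ybar)"
    unfolding partial_gateaux_differentiable2_def using lim by blast
  show "partial_gateaux_derivative2 F (xbar, ybar) u = D2 u" for u
    unfolding partial_gateaux_derivative2_def using lim by (simp add: tendsto_Lim)
qed

end
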